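(* Let $k,\rho,c,\lambda,\Theta_\infty,h>0$ be constants and set $\alpha=\frac{k}{\rho c}$, $\mathrm{Ste}=\frac{c\Theta_\infty}{\lambda}$, $\mathrm{Bi}=\frac{h\sqrt{\alpha}}{k}$. Put $$\xi^{\min}=\frac{\sqrt{4\mathrm{Ste}^2+8\mathrm{Ste}+\frac{1}{\mathrm{Bi}^2}}-\frac{1}{\mathrm{Bi}}}{2(2+\mathrm{Ste})},\qquad \xi^{\max}=\frac{\sqrt{12\mathrm{Ste}^2+36\mathrm{Ste}+\frac{9}{\mathrm{Bi}^2}}-\frac{3}{\mathrm{Bi}}}{2(3+\mathrm{Ste})}.$$ Then the polynomial equation $$z^{4}+\frac{2}{\mathrm{Bi}}z^{3}+(6+\mathrm{Ste})z^{2}+\frac{3}{\mathrm{Bi}}z-3\mathrm{Ste}=0$$ has exactly one solution $z=\xi_2$ in the interval $\xi^{\min}<z<\xi^{\max}$; the constants $$A_{2}=\frac{6\mathrm{Ste}-(6+2\mathrm{Ste})\xi_{2}^{2}-\frac{6}{\mathrm{Bi}}\xi_{2}}{\mathrm{Ste}\left(\xi_{2}^{2}+\frac{2}{\mathrm{Bi}}\xi_{2}+3\right)},\qquad B_{2}=\frac{(3\mathrm{Ste}+6)\xi_{2}^{2}+\frac{3}{\mathrm{Bi}}\xi_{2}-3\mathrm{Ste}}{\mathrm{Ste}\left(\xi_{2}^{2}+\frac{2}{\mathrm{Bi}}\xi_{2}+3\right)}$$ are positive; and the (unique) solution of Problem (P2) for a quadratic profile in space is $$T_{2}(x,t)=-A_{2}\Theta_{\infty}\left(1-\frac{x}{s_{2}(t)}\right)-B_{2}\Theta_{\infty}\left(1-\frac{x}{s_{2}(t)}\right)^{2},\qquad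 s_{2}(t)=2\xi_{2}\sqrt{\alpha t}.$$
   Context: Problem (P2): find $s_2=s_2(t)$ and $T_2=T_2(x,t)$, defined for $0\le x\le s_2(t)$, $t>0$, such that - $\dfrac{d}{dt}\displaystyle\int_{0}^{s_{2}(t)}T_{2}(x,t)\,dx=\dfrac{k}{\rho c}\left[\dfrac{\rho\lambda}{k}\dot{s}_{2}(t)-\dfrac{\partial T_2}{\partial x}(0,t)\right]$, $t>0$; - $k\dfrac{\partial T_2}{\partial x}(0,t)=\dfrac{h}{\sqrt{t}}\left(T_{2}(0,t)+\Theta_{\infty}\right)$, $t>0$; - $T_{2}(s_{2}(t),t)=0$, $t>0$; - $k\dfrac{\partial T_2}{\partial x}(s_{2}(t),t)=\rho\lambda\dot{s}_{2}(t)$, $t>0$; - $s_{2}(0)=0$. A solution "for a quadratic profile in space" is a solution pair $(T_2,s_2)$ in which $T_2(x,t)=-A\Theta_\infty\left(1-\frac{x}{s_2(t)}\right)-B\Theta_\infty\left(1-\frac{x}{s_2(t)}\right)^2$ for some constants $A>0$, $B>0$, with $s_2$ continuous on $[0,\infty)$, continuously differentiable and positive on $(0,\infty)$. *)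

theory Defs
  imports "HOL-Analysis.Analysis"
begin

(* Throughout, l is the latent heat (the symbol \<lambda> being reserved) and
   \<Theta> is \<Theta>_infinity. The temperature is a function T x t; only its values at
   t > 0 and 0 \<le> x \<le> s t carry meaning. Hence the space derivatives at the two ends
   x = 0 and x = s t are taken within the segment {0..s t}, i.e. they are one-sided.
   They are well determined because s t > 0. *)

definition solves_P2 ::
  "real \<Rightarrow> real \<Rightarrow> real \<Rightarrow> real \<Rightarrow> real \<Rightarrow> real \<Rightarrow>
   (real \<Rightarrow> real \<Rightarrow> real) \<Rightarrow> (real \<Rightarrow> real) \<Rightarrow> bool" where
  "solves_P2 k \<rho> c l \<Theta> h T s \<longleftrightarrow>
     s 0 = 0 \<and>
     (\<forall>t>0.
        s t > 0 \<and>
        s differentiable (at t) \<and>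
        (\<lambda>x. T x t) integrable_on {0..s t} \<and>
        T (s t) t = 0 \<and>
        (\<exists>Tx0 Txs.
           ((\<lambda>x. T x t) has_real_derivative Tx0) (at 0 within {0..s t}) \<and>
           ((\<lambda>x. T x t) has_real_derivative Txs) (at (s t) within {0..s t}) \<and>
           ((\<lambda>\<tau>. integral {0..s \<tau>} (\<lambda>x. T x \<tau>)) has_real_derivative
              k / (\<rho> * c) * (\<rho> * l / k * deriv s t - Tx0)) (at t) \<and>
           k * Tx0 = h / sqrt t * (T 0 t + \<Theta>) \<and>
           k * Txs = \<rho> * l * deriv s t))"

definition quadratic_profile ::
  "real \<Rightarrow> real \<Rightarrow> real \<Rightarrow> (real \<Rightarrow> real) \<Rightarrow> real \<Rightarrow> real \<Rightarrow> real" where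
  "quadratic_profile \<Theta> A B s x t =
     - A * \<Theta> * (1 - x / s t) - B * \<Theta> * (1 - x / s t)\<^sup>2"

definition quadratic_solution_P2 ::
  "real \<Rightarrow> real \<Rightarrow> real \<Rightarrow> real \<Rightarrow> real \<Rightarrow> real \<Rightarrow>
   (real \<Rightarrow> real \<Rightarrow> real) \<Rightarrow> (real \<Rightarrow> real) \<Rightarrow> bool" where
  "quadratic_solution_P2 k \<rho> c l \<Theta> h T s \<longleftrightarrow>
     solves_P2 k \<rho> c l \<Theta> h T s \<and>
     continuous_on {0..} s \<and>
     (\<forall>t>0. s differentiable (at t)) \<and> continuous_on {0<..} (deriv s) \<and>
     (\<forall>t>0. s t > 0) \<and>
     (\<exists>A>0. \<exists>B>0. \<forall>t>0. \<forall>x\<in>{0..s t}. T x t = quadratic_profile \<Theta> A B s x t)"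

end

theory Submission
  imports Defs
begin

text \<open>
  For a quadratic profile every condition of Problem (P2) at time \<open>t\<close> becomes an algebraic
  relation between \<open>A\<close>, \<open>B\<close>, \<open>s t\<close> and \<open>s' t\<close>. The convective condition alone forces
  \<open>s t = 2 z sqrt (\<alpha> t)\<close> for some \<open>z > 0\<close>; the Stefan condition then gives \<open>A = 2 z\<^sup>2 / Ste\<close>, and
  eliminating \<open>B\<close> from the two remaining relations leaves the quartic, which is strictly
  increasing on the positive half-line. The bounds of the interval are the positive zeros of
  the numerators of \<open>A\<^sub>2\<close> and \<open>B\<^sub>2\<close>, so lying between them is exactly positivity of both
  constants.
\<close>

section \<open>Calculus of a quadratic profile\<close>

lemma has_real_derivative_unique_Icc:
  fixes f :: "real \<Rightarrow> real"
  assumes "(f has_real_derivative D) (at x within {a..b})"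
    and "(f has_real_derivative E) (at x within {a..b})"
    and "a < b" "x \<in> {a..b}"
  shows "D = E"
  using vector_derivative_unique_within_closed_interval[of a b x f D E] assms
  by (simp add: has_real_derivative_iff_has_vector_derivative)

lemma quadratic_profile_has_derivative:
  assumes "s t \<noteq> 0"
  shows "((\<lambda>x. quadratic_profile \<Theta> A B s x t) has_real_derivative
    \<Theta> / s t * (A + 2 * B * (1 - x / s t))) (at x within S)"
  unfolding quadratic_profile_def using assms
  by (auto intro!: derivative_eq_intros simp: algebra_simps add_divide_distrib diff_divide_distrib)

lemma quadratic_profile_has_integral:
  assumes "s t > 0"
  shows "((\<lambda>x. quadratic_profile \<Theta> A B s x t) has_integral - \<Theta> * (A / 2 + B / 3) * s t) {0..s t}"
proof -
  \<comment> \<open>Integrate in the variable \<open>1 - x / s t\<close>: the inner derivative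
    \<open>- 1 / s t\<close> accounts for the factor \<open>s t\<close> and for the sign.
    \<open>F\<close> vanishes at \<open>x = s t\<close>, so only \<open>F 0\<close>
    contributes.\<close>
  define F where "F = (\<lambda>x. \<Theta> * s t * (A / 2 * (1 - x / s t)^2 + B / 3 * (1 - x / s t)^3))"
  have "(F has_real_derivative quadratic_profile \<Theta> A B s x t) (at x within {0..s t})" for x
    unfolding F_def quadratic_profile_def
    using assms by (auto intro!: derivative_eq_intros simp: field_simps eval_nat_numeral)
  then have "((\<lambda>x. quadratic_profile \<Theta> A B s x t) has_integral F (s t) - F 0) {0..s t}"
    using assms by (intro fundamental_theorem_of_calculus)
      (auto simp: has_real_derivative_iff_has_vector_derivative)
  moreover have "F (s t) - F 0 = - \<Theta> * (A / 2 + B / 3) * s t"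
    using assms by (simp add: F_def algebra_simps)
  ultimately show ?thesis by simp
qed

text \<open>One-sided derivatives on a nondegenerate segment are unique, so the existential
  \<open>Tx0\<close> and \<open>Txs\<close> can be replaced by their explicit values. The integral
  of the profile is a constant multiple of \<open>s\<close>, which turns the heat balance into a
  relation for \<open>deriv s\<close>. Being an equivalence, it serves both existence and
  uniqueness.\<close>

lemma solves_P2_quadratic_iff:
  assumes pos: "\<And>t. t > 0 \<Longrightarrow> s t > 0"
    and diff: "\<And>t. t > 0 \<Longrightarrow> s differentiable (at t)"
    and T: "\<And>t x. t > 0 \<Longrightarrow> x \<in> {0..s t} \<Longrightarrow> T x t = quadratic_profile \<Theta> A B s x t"
  shows "solves_P2 k \<rho> c l \<Theta> h T s \<longleftrightarrow> s 0 = 0 \<and>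
    (\<forall>t>0. - \<Theta> * (A / 2 + B / 3) * deriv s t =
             k / (\<rho> * c) * (\<rho> * l / k * deriv s t - \<Theta> / s t * (A + 2 * B)) \<and>
           k * (\<Theta> / s t * (A + 2 * B)) = h / sqrt t * (\<Theta> - (A + B) * \<Theta>) \<and>
           k * (\<Theta> / s t * A) = \<rho> * l * deriv s t)"
proof -
  have int: "((\<lambda>x. T x t) has_integral - \<Theta> * (A / 2 + B / 3) * s t) {0..s t}" if "t > 0" for t
    by (rule has_integral_eq[OF _ quadratic_profile_has_integral]) (use pos T that in auto)
  have Tx: "((\<lambda>x. T x t) has_real_derivative \<Theta> / s t * (A + 2 * B * (1 - x / s t)))
      (at x within {0..s t})" if "t > 0" "x \<in> {0..s t}" for t x
    by (rule has_field_derivative_transform_within[OF quadratic_profile_has_derivative zero_less_one])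
      (use pos that T in \<open>force+\<close>)
  have Tx0: "((\<lambda>x. T x t) has_real_derivative D) (at 0 within {0..s t}) \<longleftrightarrow>
      D = \<Theta> / s t * (A + 2 * B)" if "t > 0" for t D
    using Tx[OF that, of 0] has_real_derivative_unique_Icc pos[OF that] by fastforce
  have Txs: "((\<lambda>x. T x t) has_real_derivative D) (at (s t) within {0..s t}) \<longleftrightarrow>
      D = \<Theta> / s t * A" if "t > 0" for t D
    using Tx[OF that, of "s t"] has_real_derivative_unique_Icc pos[OF that] by fastforce
  \<comment> \<open>The integral formula is known only at positive times. These form a neighbourhood
    of \<open>t\<close>, which is all that a derivative at \<open>t\<close> sees.\<close>
  have ev: "eventually (\<lambda>\<tau>. integral {0..s \<tau>} (\<lambda>x. T x \<tau>) = - \<Theta> * (A / 2 + B / 3) * s \<tau>) (nhds t)"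
    if "t > 0" for t
  proof -
    have "eventually (\<lambda>\<tau>. \<tau> > 0) (nhds t)"
      using that by (rule order_tendstoD(1)[OF filterlim_ident])
    then show ?thesis by eventually_elim (rule integral_unique[OF int])
  qed
  have dint: "((\<lambda>\<tau>. integral {0..s \<tau>} (\<lambda>x. T x \<tau>)) has_real_derivative D) (at t) \<longleftrightarrow>
      - \<Theta> * (A / 2 + B / 3) * deriv s t = D" if "t > 0" for t D
  proof -
    have "(s has_real_derivative deriv s t) (at t)"
      using diff[OF that] DERIV_deriv_iff_real_differentiable by blast
    then have "((\<lambda>\<tau>. - \<Theta> * (A / 2 + B / 3) * s \<tau>) has_real_derivative
        - \<Theta> * (A / 2 + B / 3) * deriv s t) (at t)"
      by (rule DERIV_cmult)
    then show ?thesis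
      using DERIV_cong_ev[OF refl ev[OF that] refl] DERIV_unique by blast
  qed
  have T_ends: "T 0 t + \<Theta> = \<Theta> - (A + B) * \<Theta>" "T (s t) t = 0" if "t > 0" for t
    using pos[OF that]
    by (simp_all add: T[OF that] quadratic_profile_def algebra_simps)
  have key: "0 < s t \<and> s differentiable (at t) \<and> (\<lambda>x. T x t) integrable_on {0..s t} \<and>
    T (s t) t = 0 \<and> (\<exists>Tx0 Txs.
      ((\<lambda>x. T x t) has_real_derivative Tx0) (at 0 within {0..s t}) \<and>
      ((\<lambda>x. T x t) has_real_derivative Txs) (at (s t) within {0..s t}) \<and>
      ((\<lambda>\<tau>. integral {0..s \<tau>} (\<lambda>x. T x \<tau>)) has_real_derivative
         k / (\<rho> * c) * (\<rho> * l / k * deriv s t - Tx0)) (at t) \<and>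
      k * Tx0 = h / sqrt t * (T 0 t + \<Theta>) \<and>
      k * Txs = \<rho> * l * deriv s t) \<longleftrightarrow>
    - \<Theta> * (A / 2 + B / 3) * deriv s t =
      k / (\<rho> * c) * (\<rho> * l / k * deriv s t - \<Theta> / s t * (A + 2 * B)) \<and>
    k * (\<Theta> / s t * (A + 2 * B)) = h / sqrt t * (\<Theta> - (A + B) * \<Theta>) \<and>
    k * (\<Theta> / s t * A) = \<rho> * l * deriv s t" if "t > 0" for t
    using pos[OF that] diff[OF that] T_ends(2)[OF that] has_integral_integrable[OF int[OF that]]
    unfolding Tx0[OF that] Txs[OF that] dint[OF that] T_ends(1)[OF that] by blast
  show ?thesis
    unfolding solves_P2_def
    by (rule conj_cong[OF refl]) (rule all_cong1, rule imp_cong[OF refl], rule key)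
qed

section \<open>Sign and roots of the quadratics and of the quartic\<close>

text \<open>Completing the square leaves a comparison of two squares, and
  \<open>2 * a * z + b >= 0\<close> permits taking roots. Both signs are needed: one bounds the root
  from below, the other from above.\<close>

lemma quadratic_pos_iff:
  fixes a b d z :: real
  assumes "a > 0" "b \<ge> 0" "d > 0" "z > 0"
  shows "a * z^2 + b * z - d > 0 \<longleftrightarrow> (sqrt (b^2 + 4 * a * d) - b) / (2 * a) < z" (is ?pos)
    and "a * z^2 + b * z - d < 0 \<longleftrightarrow> z < (sqrt (b^2 + 4 * a * d) - b) / (2 * a)" (is ?neg)
proof -
  have sq: "4 * a * (a * z^2 + b * z - d) = (2 * a * z + b)^2 - (b^2 + 4 * a * d)"
    by (simp add: power2_eq_square algebra_simps)
  have nn: "2 * a * z + b \<ge> 0" using assms by simp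
  have "a * z^2 + b * z - d > 0 \<longleftrightarrow> 4 * a * (a * z^2 + b * z - d) > 0"
    using assms by (simp add: zero_less_mult_iff)
  also have "\<dots> \<longleftrightarrow> b^2 + 4 * a * d < (2 * a * z + b)^2"
    unfolding sq by simp
  also have "\<dots> \<longleftrightarrow> sqrt (b^2 + 4 * a * d) < 2 * a * z + b"
    using nn by (metis real_sqrt_abs abs_of_nonneg real_sqrt_less_iff)
  finally show ?pos using assms by (simp add: field_simps)
  have "a * z^2 + b * z - d < 0 \<longleftrightarrow> 4 * a * (a * z^2 + b * z - d) < 0"
    using assms by (simp add: mult_less_0_iff)
  also have "\<dots> \<longleftrightarrow> (2 * a * z + b)^2 < b^2 + 4 * a * d"
    unfolding sq by simp
  also have "\<dots> \<longleftrightarrow> 2 * a * z + b < sqrt (b^2 + 4 * a * d)"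
    using nn by (metis real_sqrt_abs abs_of_nonneg real_sqrt_less_iff)
  finally show ?neg using assms by (simp add: field_simps)
qed

lemma quadratic_root:
  fixes a b d :: real
  assumes "a > 0" "b \<ge> 0" "d > 0"
  defines "r \<equiv> (sqrt (b^2 + 4 * a * d) - b) / (2 * a)"
  shows "r > 0" "a * r^2 + b * r - d = 0"
proof -
  have "sqrt (b^2) < sqrt (b^2 + 4 * a * d)"
    using assms by (intro real_sqrt_less_mono) simp
  then show r: "r > 0" using assms by (simp add: r_def)
  \<comment> \<open>At \<open>z = r\<close> both strict inequalities of
    \<open>quadratic_pos_iff\<close> fail, so the quadratic is zero there.\<close>
  show "a * r^2 + b * r - d = 0"
    using quadratic_pos_iff[OF assms(1-3) r] unfolding r_def by linarith
qed

text \<open>The parameter \<open>b\<close> stands for \<open>1 / Bi\<close>, which keeps the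
  polynomial identities free of division.\<close>

definition stefan_quartic :: "real \<Rightarrow> real \<Rightarrow> real \<Rightarrow> real" where
  "stefan_quartic S b z = z^4 + 2 * b * z^3 + (6 + S) * z^2 + 3 * b * z - 3 * S"

text \<open>All nonconstant coefficients are positive; the linear term alone supplies
  strictness.\<close>

lemma stefan_quartic_strict_mono:
  assumes "S > 0" "b > 0" "0 < y" "y < z"
  shows "stefan_quartic S b y < stefan_quartic S b z"
proof -
  have "y^n \<le> z^n" for n using assms by (intro power_mono) auto
  then have "b * y^3 \<le> b * z^3" "(6 + S) * y^2 \<le> (6 + S) * z^2" "y^4 \<le> z^4" "b * y < b * z"
    using assms by auto
  then show ?thesis unfolding stefan_quartic_def by (simp add: mult.assoc)
qed

lemma stefan_quartic_pos_root_unique: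
  assumes "S > 0" "b > 0" "0 < y" "0 < z" "stefan_quartic S b y = 0" "stefan_quartic S b z = 0"
  shows "y = z"
  using assms stefan_quartic_strict_mono by (metis linorder_less_linear order_less_irrefl)

text \<open>The quadratic equation satisfied by each endpoint collapses the quartic there to an
  expression of visible sign. The intermediate value theorem then gives a root, and monotonicity its
  uniqueness.\<close>

lemma stefan_quartic_ex1:
  fixes S b :: real
  assumes S: "S > 0" and b: "b > 0"
  defines "lo \<equiv> (sqrt (b^2 + 4 * (2 + S) * S) - b) / (2 * (2 + S))"
    and "hi \<equiv> (sqrt ((3 * b)^2 + 4 * (3 + S) * (3 * S)) - 3 * b) / (2 * (3 + S))"
  shows "\<exists>!z. lo < z \<and> z < hi \<and> stefan_quartic S b z = 0"
proof -
  have lo: "lo > 0" "(2 + S) * lo^2 + b * lo - S = 0"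
    using quadratic_root[of "2 + S" b S] S b unfolding lo_def by auto
  have hi: "hi > 0" "(3 + S) * hi^2 + 3 * b * hi - 3 * S = 0"
    using quadratic_root[of "3 + S" "3 * b" "3 * S"] S b unfolding hi_def by auto
  \<comment> \<open>The relation for \<open>lo\<close> is used twice: to eliminate
    \<open>3 * S\<close>, and then, multiplied by \<open>2 * lo^2\<close>, to eliminate the
    remaining \<open>2 * S * lo^2\<close>.\<close>
  have "stefan_quartic S b lo = - (3 + 2 * S) * lo^4"
    using lo(2) unfolding stefan_quartic_def by algebra
  then have neg: "stefan_quartic S b lo < 0" using lo(1) S by (simp add: mult_less_0_iff)
  have "stefan_quartic S b hi = hi^4 + 2 * b * hi^3 + 3 * hi^2"
    using hi(2) unfolding stefan_quartic_def by algebra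
  then have pos: "stefan_quartic S b hi > 0" using hi(1) b by (simp add: add_pos_pos)
  \<comment> \<open>The endpoints are ordered by the signs of the increasing quartic, without
    comparing the two surds.\<close>
  have "lo < hi"
    using neg pos stefan_quartic_strict_mono[OF S b hi(1)] by (metis less_trans linorder_neqE order_less_asym)
  moreover have "continuous_on {lo..hi} (stefan_quartic S b)"
    unfolding stefan_quartic_def by (intro continuous_intros)
  ultimately obtain z where z: "lo \<le> z" "z \<le> hi" "stefan_quartic S b z = 0"
    using IVT'[of "stefan_quartic S b" lo 0 hi] neg pos by auto
  moreover have "z \<noteq> lo" "z \<noteq> hi" using z neg pos by auto
  ultimately have "lo < z \<and> z < hi \<and> stefan_quartic S b z = 0" by simp
  then show ?thesis
    using stefan_quartic_pos_root_unique[OF S b] lo(1) by (meson ex1I less_trans)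
qed

section \<open>Elimination of the profile constants\<close>

text \<open>The relations on the left are the Stefan condition, the heat balance and the convective
  condition. Once the first fixes \<open>A\<close>, the other two are linear in \<open>B\<close>,
  and the quartic is their compatibility condition.\<close>

lemma profile_coefficients_iff:
  fixes S b z A B :: real
  assumes "S > 0" "b > 0" "z > 0"
  defines "D \<equiv> S * (z^2 + 2 * b * z + 3)"
  shows "A * S = 2 * z^2 \<and> (A / 2 + B / 3) * A * S = 2 * B \<and> b * (A + 2 * B) = 2 * z * (1 - A - B)
    \<longleftrightarrow> stefan_quartic S b z = 0 \<and>
      A = (6 * S - (6 + 2 * S) * z^2 - 6 * b * z) / D \<and>
      B = ((3 * S + 6) * z^2 + 3 * b * z - 3 * S) / D" (is "?L \<longleftrightarrow> ?R")
proof -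
  note expand = algebra_simps power2_eq_square power3_eq_cube power4_eq_xxxx
  have D: "D > 0" unfolding D_def using assms by (simp add: add_pos_pos)
  have R: "?R \<longleftrightarrow> stefan_quartic S b z = 0 \<and> A * D = 6 * S - (6 + 2 * S) * z^2 - 6 * b * z \<and>
      B * D = (3 * S + 6) * z^2 + 3 * b * z - 3 * S"
    using D by (simp add: eq_divide_eq)
  show ?thesis
  proof
    assume ?L
    then have A: "A * S = 2 * z^2" and e1: "(A / 2 + B / 3) * A * S = 2 * B"
      and e2: "b * (A + 2 * B) = 2 * z * (1 - A - B)" by auto
    have "(A / 2 + B / 3) * (2 * z^2) = 2 * B" using A e1 by (simp add: mult.assoc)
    then have "3 * A * z^2 = 6 * B - 2 * B * z^2" by (simp add: algebra_simps)
    then have "S * (6 * B - 2 * B * z^2) = 3 * (A * S) * z^2" by simp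
    then have B1: "B * S * (3 - z^2) = 3 * z^4" unfolding A by (simp add: expand)
    have "2 * B * (b + z) = 2 * z - A * (2 * z + b)" using e2 by (simp add: algebra_simps)
    then have "S * (2 * B * (b + z)) = S * (2 * z - A * (2 * z + b))" by simp
    also have "\<dots> = 2 * z * S - (A * S) * (2 * z + b)" by (simp add: algebra_simps)
    finally have B2: "B * S * (b + z) = z * (S - 2 * z^2 - b * z)" unfolding A by (simp add: expand)
    \<comment> \<open>Cross-multiplying \<open>B1\<close> and \<open>B2\<close> eliminates
      \<open>B * S\<close> without dividing by \<open>3 - z^2\<close>, whose sign is not known
      here.\<close>
    have "z * stefan_quartic S b z =
        (b + z) * (3 * z^4) - (3 - z^2) * (z * (S - 2 * z^2 - b * z))"
      unfolding stefan_quartic_def by (simp add: expand)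
    also have "\<dots> = 0" unfolding B1[symmetric] B2[symmetric] by simp
    finally have q: "stefan_quartic S b z = 0" using assms by simp
    have "A * D = (A * S) * (z^2 + 2 * b * z + 3)" by (simp add: D_def)
    also have "\<dots> = 6 * S - (6 + 2 * S) * z^2 - 6 * b * z + 2 * stefan_quartic S b z"
      unfolding A stefan_quartic_def by (simp add: expand)
    finally have AD: "A * D = 6 * S - (6 + 2 * S) * z^2 - 6 * b * z" using q by simp
    \<comment> \<open>The denominator arises as
      \<open>(3 - z^2) + 2 * z * (b + z) = z^2 + 2 * b * z + 3\<close>, a combination of the factors
      in \<open>B1\<close> and \<open>B2\<close> that is always positive.\<close>
    have "B * D = B * S * (3 - z^2) + 2 * z * (B * S * (b + z))"
      unfolding D_def by (simp add: expand)
    also have "\<dots> = (3 * S + 6) * z^2 + 3 * b * z - 3 * S - stefan_quartic S b z"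
      unfolding B1 B2 stefan_quartic_def by (simp add: expand)
    finally have "B * D = (3 * S + 6) * z^2 + 3 * b * z - 3 * S" using q by simp
    with q AD show ?R using R by blast
  next
    assume ?R
    then have q: "stefan_quartic S b z = 0"
      and A0: "A * D = 6 * S - (6 + 2 * S) * z^2 - 6 * b * z"
      and B0: "B * D = (3 * S + 6) * z^2 + 3 * b * z - 3 * S" using R by auto
    \<comment> \<open>For the converse, the defect of each relation is multiplied by nonzero factors
      including \<open>D\<close>. The first two become multiples of the quartic; the third vanishes
      identically.\<close>
    have "(A * S - 2 * z^2) * D = S * (A * D) - 2 * z^2 * D" by (simp add: algebra_simps)
    also have "\<dots> = - 2 * S * stefan_quartic S b z"
      unfolding A0 unfolding D_def stefan_quartic_def by (simp add: expand)
    finally have A: "A * S = 2 * z^2" using q D by simp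
    have "(3 * A * z^2 - B * (6 - 2 * z^2)) * S * D =
        3 * z^2 * (A * S) * D - (6 - 2 * z^2) * S * (B * D)" by (simp add: algebra_simps)
    also have "\<dots> = S * (6 * z^2 - 6) * stefan_quartic S b z"
      unfolding A B0 unfolding D_def stefan_quartic_def by (simp add: expand)
    finally have "3 * A * z^2 = B * (6 - 2 * z^2)" using q assms(1) D by simp
    then have "(A / 2 + B / 3) * (2 * z^2) = 2 * B" by (simp add: algebra_simps)
    then have e1: "(A / 2 + B / 3) * A * S = 2 * B" using A by (simp add: mult.assoc)
    have "(b * (A + 2 * B) - 2 * z * (1 - A - B)) * D =
        (b + 2 * z) * (A * D) + 2 * (b + z) * (B * D) - 2 * z * D" by (simp add: algebra_simps)
    also have "\<dots> = 0" unfolding A0 B0 unfolding D_def by (simp add: expand)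
    finally show ?L using A e1 D by auto
  qed
qed

section \<open>Fronts proportional to the square root of time\<close>

lemma sqrt_front_has_derivative:
  fixes s :: "real \<Rightarrow> real"
  assumes s: "\<And>\<tau>. \<tau> > 0 \<Longrightarrow> s \<tau> = 2 * z * sqrt (\<alpha> * \<tau>)" and "t > 0"
  shows "(s has_real_derivative z * sqrt \<alpha> / sqrt t) (at t)"
proof -
  have "((\<lambda>\<tau>. 2 * z * (sqrt \<alpha> * sqrt \<tau>)) has_real_derivative z * sqrt \<alpha> / sqrt t) (at t)"
    using \<open>t > 0\<close> by (auto intro!: derivative_eq_intros simp: field_simps)
  then show ?thesis
    by (rule has_field_derivative_transform_within_open[of _ _ _ "{0<..}"])
      (use assms in \<open>auto simp: real_sqrt_mult\<close>)
qed

text \<open>For such a front every term of a given equation carries the same power of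
  \<open>t\<close>, so time cancels. Hence one instant suffices to extract the relations, and the
  relations suffice at every instant.\<close>

lemma P2_sqrt_front_iff:
  fixes k \<rho> c l \<Theta> h \<alpha> S b z t A B \<sigma> v :: real
  assumes pos: "k > 0" "\<rho> > 0" "c > 0" "l > 0" "\<Theta> > 0" "h > 0" "z > 0" "t > 0"
    and \<alpha>: "\<alpha> = k / (\<rho> * c)" and S: "S = c * \<Theta> / l" and b: "b = k / (h * sqrt \<alpha>)"
    and \<sigma>: "\<sigma> = 2 * z * sqrt (\<alpha> * t)" and v: "v = z * sqrt \<alpha> / sqrt t"
  shows "- \<Theta> * (A / 2 + B / 3) * v = k / (\<rho> * c) * (\<rho> * l / k * v - \<Theta> / \<sigma> * (A + 2 * B)) \<and>
      k * (\<Theta> / \<sigma> * (A + 2 * B)) = h / sqrt t * (\<Theta> - (A + B) * \<Theta>) \<and>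
      k * (\<Theta> / \<sigma> * A) = \<rho> * l * v \<longleftrightarrow>
    A * S = 2 * z^2 \<and> (A / 2 + B / 3) * A * S = 2 * B \<and> b * (A + 2 * B) = 2 * z * (1 - A - B)"
    (is "?E1 \<and> ?E2 \<and> ?E3 \<longleftrightarrow> ?F3 \<and> ?F1 \<and> ?F2")
proof -
  \<comment> \<open>With \<open>w\<close> and \<open>r\<close> in place of the roots, and
    \<open>k\<close> rewritten as \<open>w^2 * \<rho> * c\<close>, the equations become rational in
    their parameters.\<close>
  define w r where "w = sqrt \<alpha>" and "r = sqrt t"
  have w: "w > 0" "\<alpha> = w^2" and r: "r > 0"
    using pos \<alpha> by (auto simp: w_def r_def)
  have k: "k = w^2 * \<rho> * c" using \<alpha> w pos by (simp add: field_simps)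
  have \<sigma>': "\<sigma> = 2 * z * w * r" and v': "v = z * w / r"
    by (simp_all add: \<sigma> v w_def r_def real_sqrt_mult)
  have "?E3 \<longleftrightarrow> c * \<Theta> * A = 2 * z^2 * l"
    unfolding k \<sigma>' v' using pos w r by (simp add: field_simps power2_eq_square)
  also have "\<dots> \<longleftrightarrow> ?F3"
    unfolding S using pos by (simp add: field_simps)
  finally have 3: "?E3 \<longleftrightarrow> ?F3" .
  have "?E2 \<longleftrightarrow> k * (A + 2 * B) = 2 * z * w * h * (1 - A - B)"
  proof -
    have L: "k * (\<Theta> / \<sigma> * (A + 2 * B)) = (\<Theta> / (2 * z * w * r)) * (k * (A + 2 * B))"
      unfolding \<sigma>' by simp
    have R: "h / sqrt t * (\<Theta> - (A + B) * \<Theta>) =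
        (\<Theta> / (2 * z * w * r)) * (2 * z * w * h * (1 - A - B))"
      unfolding r_def[symmetric] using pos w r by (simp add: field_simps)
    have "\<Theta> / (2 * z * w * r) \<noteq> 0" using pos w r by simp
    then show ?thesis unfolding L R by (rule mult_left_cancel)
  qed
  also have "\<dots> \<longleftrightarrow> ?F2"
    unfolding b w_def[symmetric] using pos w by (simp add: field_simps)
  finally have 2: "?E2 \<longleftrightarrow> ?F2" .
  \<comment> \<open>This equivalence depends on the Stefan condition: it turns the latent heat term
    into \<open>\<Theta> / \<sigma> * A\<close>, so that the bracket reduces to a multiple of
    \<open>B\<close>, and it supplies \<open>A * S = 2 * z^2\<close>. What remains has the common
    factor \<open>C\<close>.\<close>
  have 1: "?E1 \<longleftrightarrow> ?F1" if "?E3"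
  proof -
    have AS: "A * S = 2 * z^2" using that 3 by simp
    have "\<rho> * l / k * v = \<Theta> / \<sigma> * A" using that pos by (simp add: field_simps)
    then have E1: "?E1 \<longleftrightarrow>
        - \<Theta> * (A / 2 + B / 3) * v = w^2 * (\<Theta> / \<sigma> * A - \<Theta> / \<sigma> * (A + 2 * B))"
      using \<alpha> w by simp
    define C where "C = - \<Theta> * w / (2 * z * r)"
    have L: "- \<Theta> * (A / 2 + B / 3) * v = C * ((A / 2 + B / 3) * (2 * z^2))"
      unfolding v' C_def using pos r by (simp add: power2_eq_square)
    have R: "w^2 * (\<Theta> / \<sigma> * A - \<Theta> / \<sigma> * (A + 2 * B)) = C * (2 * B)"
      unfolding \<sigma>' C_def using pos w r by (simp add: field_simps power2_eq_square)
    have "C \<noteq> 0" using pos w r by (simp add: C_def)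
    then have "?E1 \<longleftrightarrow> (A / 2 + B / 3) * (2 * z^2) = 2 * B"
      unfolding E1 unfolding L R by (rule mult_left_cancel)
    also have "\<dots> \<longleftrightarrow> ?F1" by (simp only: AS mult.assoc)
    finally show ?thesis .
  qed
  show ?thesis
  proof
    assume "?E1 \<and> ?E2 \<and> ?E3"
    then have ?E1 ?E2 ?E3 by iprover+
    then show "?F3 \<and> ?F1 \<and> ?F2" using 1 2 3 by iprover
  next
    assume *: "?F3 \<and> ?F1 \<and> ?F2"
    then have ?E3 using 3 by iprover
    with * show "?E1 \<and> ?E2 \<and> ?E3" using 1 2 by iprover
  qed
qed

text \<open>The convective condition contains no derivative of \<open>s\<close>, so it can be solved
  for \<open>s t\<close> pointwise; no differential equation has to be integrated.\<close>

lemma quadratic_solution_P2_cases: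
  assumes pos: "k > 0" "\<rho> > 0" "c > 0" "l > 0" "\<Theta> > 0" "h > 0"
    and \<alpha>: "\<alpha> = k / (\<rho> * c)" and S: "S = c * \<Theta> / l" and b: "b = k / (h * sqrt \<alpha>)"
    and sol: "quadratic_solution_P2 k \<rho> c l \<Theta> h T s"
  obtains z A B where "z > 0" "\<And>t. t \<ge> 0 \<Longrightarrow> s t = 2 * z * sqrt (\<alpha> * t)"
    "\<And>t x. t > 0 \<Longrightarrow> x \<in> {0..s t} \<Longrightarrow> T x t = quadratic_profile \<Theta> A B s x t"
    "A * S = 2 * z^2" "(A / 2 + B / 3) * A * S = 2 * B" "b * (A + 2 * B) = 2 * z * (1 - A - B)"
proof -
  have \<alpha>_pos: "\<alpha> > 0" using \<alpha> pos by simp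
  from sol obtain A B where AB: "A > 0" "B > 0"
    and T: "\<And>t x. t > 0 \<Longrightarrow> x \<in> {0..s t} \<Longrightarrow> T x t = quadratic_profile \<Theta> A B s x t"
    and s_pos: "\<And>t. t > 0 \<Longrightarrow> s t > 0" and diff: "\<And>t. t > 0 \<Longrightarrow> s differentiable (at t)"
    and P2: "solves_P2 k \<rho> c l \<Theta> h T s"
    unfolding quadratic_solution_P2_def by metis
  have alg: "s 0 = 0 \<and>
    (\<forall>t>0. - \<Theta> * (A / 2 + B / 3) * deriv s t =
             k / (\<rho> * c) * (\<rho> * l / k * deriv s t - \<Theta> / s t * (A + 2 * B)) \<and>
           k * (\<Theta> / s t * (A + 2 * B)) = h / sqrt t * (\<Theta> - (A + B) * \<Theta>) \<and>
           k * (\<Theta> / s t * A) = \<rho> * l * deriv s t)"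
    by (rule iffD1[OF solves_P2_quadratic_iff[where s = s and T = T and \<Theta> = \<Theta> and A = A and B = B] P2])
      (rule s_pos diff T; assumption)+
  \<comment> \<open>\<open>\<Theta> * q\<close> is the value of \<open>T 0 t + \<Theta>\<close>.
    Positivity of \<open>A\<close> and \<open>B\<close> makes the left side of \<open>eq\<close>
    positive, and its instance at time 1 gives \<open>q > 0\<close>, which allows division by
    \<open>q\<close>.\<close>
  define q where "q = 1 - A - B"
  have eq: "k * (A + 2 * B) * sqrt t = s t * h * q" if "t > 0" for t
  proof -
    have "k * (\<Theta> / s t * (A + 2 * B)) = h / sqrt t * (\<Theta> - (A + B) * \<Theta>)"
      using alg that by blast
    also have "\<dots> = h / sqrt t * (\<Theta> * q)" by (simp add: q_def algebra_simps)
    finally have "\<Theta> * (k * (A + 2 * B) * sqrt t) = \<Theta> * (s t * h * q)"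
      using that pos s_pos[OF that] by (simp add: field_simps)
    then show ?thesis using pos by simp
  qed
  have "k * (A + 2 * B) * sqrt 1 > 0" using pos AB by simp
  then have q: "q > 0"
    unfolding eq[OF zero_less_one]
    by (rule zero_less_mult_pos) (use pos s_pos[OF zero_less_one] in simp)
  define z where "z = k * (A + 2 * B) / (2 * h * q * sqrt \<alpha>)"
  have z: "z > 0" using pos AB q \<alpha>_pos by (simp add: z_def)
  have s: "s t = 2 * z * sqrt (\<alpha> * t)" if "t > 0" for t
  proof -
    have "s t = k * (A + 2 * B) * sqrt t / (h * q)"
      using eq[OF that] pos q by (simp add: eq_divide_eq mult_ac)
    then show ?thesis using pos q \<alpha>_pos by (simp add: z_def real_sqrt_mult)
  qed
  \<comment> \<open>The remaining relations are free of time, so they are read off at time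
    1.\<close>
  have "deriv s 1 = z * sqrt \<alpha> / sqrt 1"
    by (rule DERIV_imp_deriv[OF sqrt_front_has_derivative[OF s zero_less_one]])
  note rel = P2_sqrt_front_iff[OF pos z zero_less_one \<alpha> S b s[OF zero_less_one] this,
      THEN iffD1, OF alg[THEN conjunct2, rule_format, OF zero_less_one]]
  have "s t = 2 * z * sqrt (\<alpha> * t)" if "t \<ge> 0" for t
    using s[of t] alg that by (cases "t = 0") auto
  with z T rel show thesis by (intro that) auto
qed

lemma quadratic_solution_P2I:
  assumes pos: "k > 0" "\<rho> > 0" "c > 0" "l > 0" "\<Theta> > 0" "h > 0" and "z > 0" "A > 0" "B > 0"
    and \<alpha>: "\<alpha> = k / (\<rho> * c)" and S: "S = c * \<Theta> / l" and b: "b = k / (h * sqrt \<alpha>)"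
    and s: "s = (\<lambda>t. 2 * z * sqrt (\<alpha> * t))"
    and rel: "A * S = 2 * z^2 \<and> (A / 2 + B / 3) * A * S = 2 * B \<and>
      b * (A + 2 * B) = 2 * z * (1 - A - B)"
  shows "quadratic_solution_P2 k \<rho> c l \<Theta> h (quadratic_profile \<Theta> A B s) s"
proof -
  have s_pos: "s t > 0" if "t > 0" for t
    using that assms by simp
  have deriv: "(s has_real_derivative z * sqrt \<alpha> / sqrt t) (at t)" if "t > 0" for t
    using that by (intro sqrt_front_has_derivative) (simp_all add: s)
  then have diff: "s differentiable (at t)" if "t > 0" for t
    using that real_differentiable_def by blast
  have deriv_eq: "deriv s t = z * sqrt \<alpha> / sqrt t" if "t > 0" for t
    using deriv[OF that] by (rule DERIV_imp_deriv)
  have "solves_P2 k \<rho> c l \<Theta> h (quadratic_profile \<Theta> A B s) s"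
  proof (intro solves_P2_quadratic_iff[where A = A and B = B, OF s_pos diff refl, THEN iffD2]
       conjI[of "s 0 = 0"] allI impI)
    fix t :: real assume "t > 0"
    then show "- \<Theta> * (A / 2 + B / 3) * deriv s t =
             k / (\<rho> * c) * (\<rho> * l / k * deriv s t - \<Theta> / s t * (A + 2 * B)) \<and>
           k * (\<Theta> / s t * (A + 2 * B)) = h / sqrt t * (\<Theta> - (A + B) * \<Theta>) \<and>
           k * (\<Theta> / s t * A) = \<rho> * l * deriv s t"
      using P2_sqrt_front_iff[OF pos \<open>z > 0\<close> _ \<alpha> S b _ deriv_eq, THEN iffD2, OF _ _ _ rel] s
      by simp
  next
    show "s 0 = 0" unfolding s by simp
  qed
  moreover have "continuous_on {0..} s"
    unfolding s by (intro continuous_intros)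
  moreover have "continuous_on {0<..} (\<lambda>t. z * sqrt \<alpha> / sqrt t)"
    by (intro continuous_intros) auto
  then have "continuous_on {0<..} (deriv s)"
    using continuous_on_cong[OF refl, of "{0<..}" "deriv s"] deriv_eq by auto
  moreover have "\<exists>A'>0. \<exists>B'>0. \<forall>t>0. \<forall>x\<in>{0..s t}.
      quadratic_profile \<Theta> A B s x t = quadratic_profile \<Theta> A' B' s x t"
    using \<open>A > 0\<close> \<open>B > 0\<close> by blast
  ultimately show ?thesis
    unfolding quadratic_solution_P2_def by (intro conjI allI impI s_pos diff) assumption+
qed

section \<open>Existence and uniqueness of the quadratic solution\<close>

theorem theorem3p2:
  fixes k \<rho> c l \<Theta> h \<alpha> Ste Bi \<xi>min \<xi>max :: real
  assumes "k > 0" "\<rho> > 0" "c > 0" "l > 0" "\<Theta> > 0" "h > 0"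
    and "\<alpha> = k / (\<rho> * c)"
    and "Ste = c * \<Theta> / l"
    and "Bi = h * sqrt \<alpha> / k"
    and "\<xi>min = (sqrt (4 * Ste^2 + 8 * Ste + 1 / Bi^2) - 1 / Bi) / (2 * (2 + Ste))"
    and "\<xi>max = (sqrt (12 * Ste^2 + 36 * Ste + 9 / Bi^2) - 3 / Bi) / (2 * (3 + Ste))"
  shows
    "(\<exists>!z. \<xi>min < z \<and> z < \<xi>max \<and>
        z^4 + 2 / Bi * z^3 + (6 + Ste) * z^2 + 3 / Bi * z - 3 * Ste = 0) \<and>
     (\<forall>\<xi>2. \<xi>min < \<xi>2 \<and> \<xi>2 < \<xi>max \<and>
        \<xi>2^4 + 2 / Bi * \<xi>2^3 + (6 + Ste) * \<xi>2^2 + 3 / Bi * \<xi>2 - 3 * Ste = 0 \<longrightarrow>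
        (let A2 = (6 * Ste - (6 + 2 * Ste) * \<xi>2^2 - 6 / Bi * \<xi>2)
                    / (Ste * (\<xi>2^2 + 2 / Bi * \<xi>2 + 3));
             B2 = ((3 * Ste + 6) * \<xi>2^2 + 3 / Bi * \<xi>2 - 3 * Ste)
                    / (Ste * (\<xi>2^2 + 2 / Bi * \<xi>2 + 3));
             s2 = (\<lambda>t. 2 * \<xi>2 * sqrt (\<alpha> * t));
             T2 = quadratic_profile \<Theta> A2 B2 s2
         in A2 > 0 \<and> B2 > 0 \<and>
            quadratic_solution_P2 k \<rho> c l \<Theta> h T2 s2 \<and>
            (\<forall>T s. quadratic_solution_P2 k \<rho> c l \<Theta> h T s \<longrightarrow>
               (\<forall>t\<ge>0. s t = s2 t) \<and>
               (\<forall>t>0. \<forall>x\<in>{0..s2 t}. T x t = T2 x t))))"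
proof -
  let ?A2 = "\<lambda>z. (6 * Ste - (6 + 2 * Ste) * z^2 - 6 / Bi * z) / (Ste * (z^2 + 2 / Bi * z + 3))"
  let ?B2 = "\<lambda>z. ((3 * Ste + 6) * z^2 + 3 / Bi * z - 3 * Ste) / (Ste * (z^2 + 2 / Bi * z + 3))"
  let ?s2 = "\<lambda>z t. 2 * z * sqrt (\<alpha> * t)"
  define b where "b = 1 / Bi"
  have \<alpha>_pos: "\<alpha> > 0" and S_pos: "Ste > 0" and "Bi > 0" using assms by auto
  then have b_pos: "b > 0" by (simp add: b_def)
  have b: "b = k / (h * sqrt \<alpha>)" using assms by (simp add: b_def)
  have lo: "\<xi>min = (sqrt (b^2 + 4 * (2 + Ste) * Ste) - b) / (2 * (2 + Ste))"
    using assms(10) by (simp add: b_def power_divide power2_eq_square algebra_simps)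
  have hi: "\<xi>max = (sqrt ((3 * b)^2 + 4 * (3 + Ste) * (3 * Ste)) - 3 * b) / (2 * (3 + Ste))"
    using assms(11) by (simp add: b_def power_divide power2_eq_square algebra_simps)
  have lo_pos: "\<xi>min > 0"
    using quadratic_root(1)[of "2 + Ste" b Ste] S_pos b_pos unfolding lo by simp
  have quartic: "z^4 + 2 / Bi * z^3 + (6 + Ste) * z^2 + 3 / Bi * z - 3 * Ste =
      stefan_quartic Ste b z" for z
    by (simp add: stefan_quartic_def b_def)
  have ex1: "\<exists>!z. \<xi>min < z \<and> z < \<xi>max \<and> stefan_quartic Ste b z = 0"
    unfolding lo hi by (rule stefan_quartic_ex1[OF S_pos b_pos])
  have main: "A2 > 0 \<and> B2 > 0 \<and>
      quadratic_solution_P2 k \<rho> c l \<Theta> h (quadratic_profile \<Theta> A2 B2 s2) s2 \<and>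
      (\<forall>T s. quadratic_solution_P2 k \<rho> c l \<Theta> h T s \<longrightarrow>
         (\<forall>t\<ge>0. s t = s2 t) \<and>
         (\<forall>t>0. \<forall>x\<in>{0..s2 t}. T x t = quadratic_profile \<Theta> A2 B2 s2 x t))"
    if z: "\<xi>min < z" "z < \<xi>max" and root: "stefan_quartic Ste b z = 0"
      and A2: "A2 = (6 * Ste - (6 + 2 * Ste) * z^2 - 6 * b * z) / (Ste * (z^2 + 2 * b * z + 3))"
      and B2: "B2 = ((3 * Ste + 6) * z^2 + 3 * b * z - 3 * Ste) / (Ste * (z^2 + 2 * b * z + 3))"
      and s2: "s2 = (\<lambda>t. 2 * z * sqrt (\<alpha> * t))"
    for z A2 B2 :: real and s2 :: "real \<Rightarrow> real"
  proof -
    have z_pos: "z > 0" using lo_pos z by simp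
    have D: "Ste * (z^2 + 2 * b * z + 3) > 0"
      using S_pos b_pos z_pos by (simp add: add_pos_pos)
    \<comment> \<open>The numerator of \<open>A2\<close> is \<open>-2\<close> times this quadratic,
      whose positive zero is \<open>\<xi>max\<close>.\<close>
    have "(3 + Ste) * z^2 + 3 * b * z - 3 * Ste < 0"
      using quadratic_pos_iff(2)[of "3 + Ste" "3 * b" "3 * Ste" z] S_pos b_pos z_pos z(2)
      unfolding hi by simp
    then have "6 * Ste - (6 + 2 * Ste) * z^2 - 6 * b * z > 0" by (simp add: algebra_simps)
    then have A2_pos: "A2 > 0" unfolding A2 using D by (rule divide_pos_pos)
    \<comment> \<open>The numerator of \<open>B2\<close> is \<open>3\<close> times this quadratic,
      whose positive zero is \<open>\<xi>min\<close>.\<close>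
    have "(2 + Ste) * z^2 + b * z - Ste > 0"
      using quadratic_pos_iff(1)[of "2 + Ste" b Ste z] S_pos b_pos z_pos z(1)
      unfolding lo by simp
    then have "(3 * Ste + 6) * z^2 + 3 * b * z - 3 * Ste > 0" by (simp add: algebra_simps)
    then have B2_pos: "B2 > 0" unfolding B2 using D by (rule divide_pos_pos)
    have "quadratic_solution_P2 k \<rho> c l \<Theta> h (quadratic_profile \<Theta> A2 B2 s2) s2"
      using quadratic_solution_P2I[OF assms(1-6) z_pos A2_pos B2_pos assms(7,8) b s2]
        profile_coefficients_iff[OF S_pos b_pos z_pos] root A2 B2 by blast
    moreover have "(\<forall>t\<ge>0. s t = s2 t) \<and>
        (\<forall>t>0. \<forall>x\<in>{0..s2 t}. T x t = quadratic_profile \<Theta> A2 B2 s2 x t)"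
      if sol: "quadratic_solution_P2 k \<rho> c l \<Theta> h T s" for T s
    proof -
      obtain y A B where y: "y > 0" and s: "\<And>t. t \<ge> 0 \<Longrightarrow> s t = 2 * y * sqrt (\<alpha> * t)"
        and T: "\<And>t x. t > 0 \<Longrightarrow> x \<in> {0..s t} \<Longrightarrow> T x t = quadratic_profile \<Theta> A B s x t"
        and rel: "A * Ste = 2 * y^2" "(A / 2 + B / 3) * A * Ste = 2 * B"
          "b * (A + 2 * B) = 2 * y * (1 - A - B)"
        by (rule quadratic_solution_P2_cases[OF assms(1-8) b sol]) blast
      note coeff = profile_coefficients_iff[OF S_pos b_pos y, THEN iffD1, OF conjI[OF rel(1) conjI[OF rel(2,3)]]]
      \<comment> \<open>The competing root \<open>y\<close> is not known to lie between the bounds;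
        positivity is enough, since the quartic has at most one positive root.\<close>
      have "y = z"
        using stefan_quartic_pos_root_unique[OF S_pos b_pos y z_pos] coeff root by blast
      then have "A = A2" "B = B2" and s_eq: "\<And>t. t \<ge> 0 \<Longrightarrow> s t = s2 t"
        using coeff s by (simp_all add: A2 B2 s2)
      then show ?thesis
        using T by (simp add: quadratic_profile_def)
    qed
    ultimately show ?thesis using A2_pos B2_pos by blast
  qed
  show ?thesis
    unfolding Let_def quartic
  proof (rule conjI[OF ex1], rule allI, rule impI)
    fix \<xi>2
    assume "\<xi>min < \<xi>2 \<and> \<xi>2 < \<xi>max \<and> stefan_quartic Ste b \<xi>2 = 0"
    then have "\<xi>min < \<xi>2" "\<xi>2 < \<xi>max" "stefan_quartic Ste b \<xi>2 = 0" by iprover+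
    then show "?A2 \<xi>2 > 0 \<and> ?B2 \<xi>2 > 0 \<and>
        quadratic_solution_P2 k \<rho> c l \<Theta> h
          (quadratic_profile \<Theta> (?A2 \<xi>2) (?B2 \<xi>2) (?s2 \<xi>2)) (?s2 \<xi>2) \<and>
        (\<forall>T s. quadratic_solution_P2 k \<rho> c l \<Theta> h T s \<longrightarrow>
           (\<forall>t\<ge>0. s t = ?s2 \<xi>2 t) \<and>
           (\<forall>t>0. \<forall>x\<in>{0..?s2 \<xi>2 t}.
              T x t = quadratic_profile \<Theta> (?A2 \<xi>2) (?B2 \<xi>2) (?s2 \<xi>2) x t))"
      by (rule main) (simp_all add: b_def)
  qed
qed

end
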